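(* Let $V\subset\mathbb{R}^{n+1}$ be open and let $F=(F^1,\dots,F^n):V\to\mathbb{R}^n$, $F=F(t,y)$, be a continuous function with modulus of continuity $w_1$. Write $(\xi^1,\dots,\xi^{n+1})=(t,y^1,\dots,y^n)$ and $\tilde F=(\tilde F^1,\dots,\tilde F^{n+1})=(1,F^1,\dots,F^n)$. Let $\xi=(t_0,y_0)\in V$ and $i\in\{1,\dots,n+1\}$ be such that $\tilde F^i(\xi)\ne0$, and suppose that $\tilde F$ has modulus of continuity $w_2$ with respect to the variables $(\xi^1,\dots,\xi^{i-1},\xi^{i+1},\dots,\xi^{n+1})$ and that $$\lim_{s\to0}w_1(s)\,e^{w_2(s)/s}=0.$$ Then the ODE $$\frac{dy^j}{dt}=F^j(t,y(t)),\qquad j=1,\dots,n,$$ with initial condition $y(t_0)=y_0$ has a unique (local) solution.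
   Context: Let $w:\mathbb{R}^+\to\mathbb{R}^+$ be an increasing continuous function with $\lim_{s\to0}w(s)=0$. A function $G:U\subset\mathbb{R}^N\to\mathbb{R}^M$ has modulus of continuity $w$ with respect to the variable $\xi^i$ if there is a constant $K>0$ such that for all $(\xi^1,\dots,\xi^N)\in U$ and all $s$ small enough that $(\xi^1,\dots,\xi^i+s,\dots,\xi^N)\in U$, $|G(\xi^1,\dots,\xi^i+s,\dots,\xi^N)-G(\xi^1,\dots,\xi^N)|\le Kw(|s|)$. $G$ has modulus of continuity $w$ if it has modulus of continuity $w$ with respect to all variables. The functions $w_1,w_2$ are of this type. Unique local solution means: a solution exists on some interval around $t_0$, and any two solutions with the same initial condition coincide on a neighbourhood of $t_0$. *)

theory Defs
  imports "HOL-Analysis.Analysis"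
begin

(* The domain is taken to be the closed half-line, so that w \<bar>s\<bar> makes sense at s = 0;
   a function given on the open half-line extends by w 0 = 0. *)
definition modulus_function :: "(real \<Rightarrow> real) \<Rightarrow> bool" where
  "modulus_function w \<longleftrightarrow>
     (\<forall>s\<ge>0. w s \<ge> 0) \<and> mono_on {0..} w \<and> continuous_on {0..} w \<and> (w \<longlongrightarrow> 0) (at_right 0)"

(* The coordinates of the domain are indexed by its standard basis vectors e. *)
definition has_modulus_wrt ::
  "('a::euclidean_space \<Rightarrow> 'b::euclidean_space) \<Rightarrow> 'a set \<Rightarrow> (real \<Rightarrow> real) \<Rightarrow> 'a \<Rightarrow> bool" where
  "has_modulus_wrt G U w e \<longleftrightarrow>
     (\<exists>K>0. \<forall>x\<in>U. \<forall>s::real. x + s *\<^sub>R e \<in> U \<longrightarrow> norm (G (x + s *\<^sub>R e) - G x) \<le> K * w \<bar>s\<bar>)"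

definition has_modulus ::
  "('a::euclidean_space \<Rightarrow> 'b::euclidean_space) \<Rightarrow> 'a set \<Rightarrow> (real \<Rightarrow> real) \<Rightarrow> bool" where
  "has_modulus G U w \<longleftrightarrow> (\<forall>e\<in>Basis. has_modulus_wrt G U w e)"

definition extended_field ::
  "(real \<times> (real ^ 'n) \<Rightarrow> (real ^ 'n)) \<Rightarrow> real \<times> (real ^ 'n) \<Rightarrow> real \<times> (real ^ 'n)" where
  "extended_field F \<xi> = (1, F \<xi>)"

definition solves_ivp ::
  "(real \<times> (real ^ 'n)) set \<Rightarrow> (real \<times> (real ^ 'n) \<Rightarrow> (real ^ 'n)) \<Rightarrow> real \<Rightarrow> (real ^ 'n)
     \<Rightarrow> real set \<Rightarrow> (real \<Rightarrow> (real ^ 'n)) \<Rightarrow> bool" where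
  "solves_ivp V F t0 y0 I y \<longleftrightarrow>
     open I \<and> is_interval I \<and> t0 \<in> I \<and> y t0 = y0 \<and>
     (\<forall>t\<in>I. (t, y t) \<in> V \<and> (y has_vector_derivative F (t, y t)) (at t))"

definition unique_local_solution ::
  "(real \<times> (real ^ 'n)) set \<Rightarrow> (real \<times> (real ^ 'n) \<Rightarrow> (real ^ 'n)) \<Rightarrow> real \<Rightarrow> (real ^ 'n) \<Rightarrow> bool" where
  "unique_local_solution V F t0 y0 \<longleftrightarrow>
     (\<exists>I y. solves_ivp V F t0 y0 I y) \<and>
     (\<forall>I y J z. solves_ivp V F t0 y0 I y \<longrightarrow> solves_ivp V F t0 y0 J z \<longrightarrow>
        (\<forall>\<^sub>F t in nhds t0. y t = z t))"

end

(* Existence is Peano's theorem, obtained from solutions with a small time delay and the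
   Arzela-Ascoli theorem. For uniqueness, a solution is viewed as an integral curve of the field
   (1, F) in space-time and is parametrized by the coordinate along e, which is possible because
   the e-component of the field does not vanish. Two such curves differ only in the other
   coordinates, where the field has modulus w = min w1 w2. Splitting a segment into pieces of length
   at most s gives |G x - G y| <= C (w s / s) (|x - y| + s) for every s > 0, so Gronwall's inequality
   bounds the distance of the curves by s exp (w s / s) on an interval that does not depend on s.
   This bound tends to 0 with s by the hypothesis on w1 and w2. *)

theory Submission
  imports Defs "HOL-Complex_Analysis.Great_Picard"
begin

section \<open>Peano's existence theorem\<close>

lemma vector_lipschitz_bound:
  fixes Y :: "real \<Rightarrow> 'a::real_normed_vector"
  assumes "convex S"
    and "\<And>t. t \<in> S \<Longrightarrow> (Y has_vector_derivative v t) (at t within S)"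
    and "\<And>t. t \<in> S \<Longrightarrow> norm (v t) \<le> M"
    and "s \<in> S" "t \<in> S"
  shows "norm (Y s - Y t) \<le> M * \<bar>s - t\<bar>"
proof -
  have "norm (Y s - Y t) \<le> M * norm (s - t)"
  proof (rule differentiable_bound[OF assms(1) _ _ assms(4,5)])
    fix x assume x: "x \<in> S"
    show "(Y has_derivative (\<lambda>h. h *\<^sub>R v x)) (at x within S)"
      using assms(2)[OF x] by (simp add: has_vector_derivative_def)
    show "onorm (\<lambda>h. h *\<^sub>R v x) \<le> M"
      using assms(3)[OF x] by (intro onorm_le) (simp add: mult.commute[of M] mult_left_mono)
  qed
  then show ?thesis by simp
qed

text \<open>The delayed time \<open>d t\<close> lies \<open>h\<close> closer to \<open>t0\<close>
  than \<open>t\<close>, or equals \<open>t0\<close> when \<open>t\<close> is within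
  \<open>h\<close> of it. Knowing \<open>Y\<close> up to distance \<open>m * h\<close> from
  \<open>t0\<close> thus determines the right-hand side up to distance \<open>(m + 1) * h\<close>:
  this is the method of steps, run on both sides of \<open>t0\<close> at once.\<close>

lemma delayed_ode_solution:
  fixes f :: "real \<times> 'a::euclidean_space \<Rightarrow> 'a"
    and t0 :: real and y0 :: 'a
  assumes cont: "continuous_on UNIV f" and bound: "\<And>x. norm (f x) \<le> M" and h: "0 < h"
  defines "d \<equiv> \<lambda>t. t - max (- h) (min h (t - t0))"
  shows "\<exists>Y. Y t0 = y0 \<and>
    (\<forall>t\<in>{t0-1..t0+1}. (Y has_vector_derivative f (t, Y (d t))) (at t within {t0-1..t0+1}))"
proof -
  let ?I = "{t0-1..t0+1}"
  have dI: "d t \<in> ?I" if "t \<in> ?I" for t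
    using that h by (auto simp: d_def)
  have dcont: "continuous_on S d" for S
    unfolding d_def by (intro continuous_intros)
  \<comment> \<open>Each approximation is defined on the whole interval, and only the range on which
    it satisfies the delayed equation grows with \<open>m\<close>. This avoids gluing pieces
    together.\<close>
  have P: "\<exists>Y v. Y t0 = y0 \<and>
      (\<forall>t\<in>?I. norm (v t) \<le> M \<and> (Y has_vector_derivative v t) (at t within ?I)) \<and>
      (\<forall>t\<in>?I. \<bar>t - t0\<bar> \<le> real m * h \<longrightarrow> v t = f (t, Y (d t)))" for m :: nat
  proof (induction m)
    case 0
    \<comment> \<open>For \<open>m = 0\<close> the equation is demanded only at \<open>t0\<close>,
      where \<open>d t0 = t0\<close>, so an affine function with the right slope suffices.\<close>
    define Y where "Y = (\<lambda>t. y0 + (t - t0) *\<^sub>R f (t0, y0))"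
    have "(Y has_vector_derivative f (t0, y0)) (at t within ?I)" for t
      unfolding Y_def has_vector_derivative_def by (auto intro!: derivative_eq_intros)
    moreover have "Y t0 = y0" "d t0 = t0" using h by (auto simp: Y_def d_def)
    moreover have "f (t0, y0) = f (t, Y (d t))" if "\<bar>t - t0\<bar> \<le> real 0 * h" for t
      using that \<open>Y t0 = y0\<close> \<open>d t0 = t0\<close> by simp
    ultimately have "Y t0 = y0 \<and>
      (\<forall>t\<in>?I. norm (f (t0, y0)) \<le> M \<and> (Y has_vector_derivative f (t0, y0)) (at t within ?I)) \<and>
      (\<forall>t\<in>?I. \<bar>t - t0\<bar> \<le> real 0 * h \<longrightarrow> f (t0, y0) = f (t, Y (d t)))"
      using bound by blast
    then show ?case by (intro exI)
  next
    case (Suc m)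
    then obtain Y v where Y0: "Y t0 = y0"
      and v: "\<And>t. t \<in> ?I \<Longrightarrow> norm (v t) \<le> M"
      and Y: "\<And>t. t \<in> ?I \<Longrightarrow> (Y has_vector_derivative v t) (at t within ?I)"
      and vf: "\<And>t. t \<in> ?I \<Longrightarrow> \<bar>t - t0\<bar> \<le> real m * h \<Longrightarrow> v t = f (t, Y (d t))" by blast
    have Ycont: "continuous_on ?I Y"
      using Y has_vector_derivative_continuous continuous_on_eq_continuous_within by blast
    have "continuous_on ?I (\<lambda>t. Y (d t))"
      by (rule continuous_on_compose2[OF Ycont dcont]) (use dI in auto)
    then have "continuous_on ?I (\<lambda>t. f (t, Y (d t)))"
      by (rule continuous_on_compose2[OF cont continuous_on_Pair[OF continuous_on_id]]) simp
    then obtain W where W: "\<And>t. t \<in> ?I \<Longrightarrow> (W has_vector_derivative f (t, Y (d t))) (at t within ?I)"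
      by (rule antiderivative_continuous) blast
    \<comment> \<open>A Picard step: an antiderivative of the right-hand side formed with
      \<open>Y\<close>, shifted to have the value \<open>y0\<close> at \<open>t0\<close>.\<close>
    define Z where "Z = (\<lambda>t. W t - W t0 + y0)"
    have Z0: "Z t0 = y0" by (simp add: Z_def)
    have Z: "(Z has_vector_derivative f (t, Y (d t))) (at t within ?I)" if "t \<in> ?I" for t
      unfolding Z_def using W[OF that] by (auto intro!: derivative_eq_intros)
    let ?S = "{t\<in>?I. \<bar>t - t0\<bar> \<le> real m * h}"
    have Seq: "?S = ?I \<inter> {t0 - real m * h .. t0 + real m * h}" by auto
    \<comment> \<open>Where \<open>Y\<close> already satisfies the delayed equation,
      \<open>Z\<close> has the same derivative as \<open>Y\<close>; the two also agree at
      \<open>t0\<close>.\<close>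
    have ZY: "Z t = Y t" if t: "t \<in> ?S" for t
    proof -
      have "norm ((Z t - Y t) - (Z t0 - Y t0)) \<le> 0 * \<bar>t - t0\<bar>"
      proof (rule vector_lipschitz_bound[where S = ?S and v = "\<lambda>_. 0"])
        show "convex ?S" unfolding Seq by (intro convex_Int) auto
        fix t assume t: "t \<in> ?S"
        have "((\<lambda>t. Z t - Y t) has_vector_derivative f (t, Y (d t)) - v t) (at t within ?I)"
          using t Z Y by (intro has_vector_derivative_diff) auto
        then have "((\<lambda>t. Z t - Y t) has_vector_derivative 0) (at t within ?I)"
          using vf t by simp
        then show "((\<lambda>t. Z t - Y t) has_vector_derivative 0) (at t within ?S)"
          by (rule has_vector_derivative_within_subset) auto
      qed (use t h in auto)
      then show ?thesis using Z0 Y0 by simp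
    qed
    \<comment> \<open>The delay brings the enlarged range back into \<open>?S\<close>, where
      \<open>Z\<close> may replace \<open>Y\<close>. Hence \<open>Z\<close> satisfies its own
      delayed equation one step further.\<close>
    have dS: "d t \<in> ?S" if "t \<in> ?I" "\<bar>t - t0\<bar> \<le> real (Suc m) * h" for t
    proof -
      have "\<bar>t - t0\<bar> \<le> real m * h + h" using that(2) by (simp add: algebra_simps)
      moreover have "0 \<le> real m * h" using h by simp
      ultimately have "\<bar>d t - t0\<bar> \<le> real m * h" using h unfolding d_def by linarith
      with dI[OF that(1)] show ?thesis by simp
    qed
    have "f (t, Y (d t)) = f (t, Z (d t))" if "t \<in> ?I" "\<bar>t - t0\<bar> \<le> real (Suc m) * h" for t
      using ZY[OF dS[OF that]] by simp
    then have "Z t0 = y0 \<and>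
      (\<forall>t\<in>?I. norm (f (t, Y (d t))) \<le> M \<and> (Z has_vector_derivative f (t, Y (d t))) (at t within ?I)) \<and>
      (\<forall>t\<in>?I. \<bar>t - t0\<bar> \<le> real (Suc m) * h \<longrightarrow> f (t, Y (d t)) = f (t, Z (d t)))"
      using Z0 Z bound by blast
    then show ?case by (intro exI)
  qed
  obtain m :: nat where m: "1 \<le> real m * h"
    by (metis h less_imp_le reals_Archimedean3)
  from P[of m] obtain Y v where "Y t0 = y0"
      "\<forall>t\<in>?I. (Y has_vector_derivative v t) (at t within ?I)"
      "\<forall>t\<in>?I. \<bar>t - t0\<bar> \<le> real m * h \<longrightarrow> v t = f (t, Y (d t))" by blast
  moreover have "\<bar>t - t0\<bar> \<le> real m * h" if "t \<in> ?I" for t using that m by auto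
  ultimately show ?thesis by (intro exI[of _ Y]) auto
qed

text \<open>All delayed solutions share the Lipschitz constant \<open>M\<close>, so Arzela-Ascoli
  yields a uniformly convergent subsequence. A delay \<open>h n\<close> changes their values by at
  most \<open>M * h n\<close>, so the delayed functions have the same limit, and uniform continuity
  of \<open>f\<close> on a compact set lets the equation pass to that limit.\<close>

lemma Peano_existence_bounded:
  fixes f :: "real \<times> 'a::euclidean_space \<Rightarrow> 'a"
    and t0 :: real and y0 :: 'a
  assumes cont: "continuous_on UNIV f" and bound: "\<And>x. norm (f x) \<le> M"
  shows "\<exists>y. y t0 = y0 \<and>
    (\<forall>t\<in>{t0-1..t0+1}. (y has_vector_derivative f (t, y t)) (at t within {t0-1..t0+1}))"
proof -
  let ?I = "{t0-1..t0+1}"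
  define h where "h = (\<lambda>n::nat. 1 / real (Suc n))"
  define d where "d = (\<lambda>n t. t - max (- h n) (min (h n) (t - t0)))"
  have h: "0 < h n" for n by (simp add: h_def)
  have "\<forall>n. \<exists>Y. Y t0 = y0 \<and>
      (\<forall>t\<in>?I. (Y has_vector_derivative f (t, Y (d n t))) (at t within ?I))"
    unfolding d_def using delayed_ode_solution[OF cont bound h] by blast
  then obtain Y where Y0: "\<And>n. Y n t0 = y0"
    and Y: "\<And>n t. t \<in> ?I \<Longrightarrow> (Y n has_vector_derivative f (t, Y n (d n t))) (at t within ?I)"
    by metis
  have M: "0 \<le> M" using bound norm_ge_zero order_trans by blast
  have Lip: "norm (Y n s - Y n t) \<le> M * \<bar>s - t\<bar>" if "s \<in> ?I" "t \<in> ?I" for n s t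
    using vector_lipschitz_bound[OF _ Y bound that] by auto
  have dI: "d n t \<in> ?I" if "t \<in> ?I" for n t
    using that h[of n] by (auto simp: d_def)
  have dt: "\<bar>d n t - t\<bar> \<le> h n" for n t
    using h[of n] by (auto simp: d_def)
  \<comment> \<open>The interval has radius 1, so the values stay within \<open>M\<close> of
    \<open>y0\<close>. This serves both as the uniform bound for Arzela-Ascoli and to find the
    compact set on which \<open>f\<close> is uniformly continuous.\<close>
  have near: "norm (Y n t - y0) \<le> M" if "t \<in> ?I" for n t
  proof -
    have "norm (Y n t - Y n t0) \<le> M * \<bar>t - t0\<bar>" using Lip[OF that, of t0 n] by simp
    also have "\<dots> \<le> M * 1" using that M by (intro mult_left_mono) auto
    finally show ?thesis by (simp add: Y0)
  qed
  obtain y k where ycont: "continuous_on ?I y" and k: "strict_mono (k :: nat \<Rightarrow> nat)"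
    and conv: "\<And>e. 0 < e \<Longrightarrow> \<exists>N. \<forall>n x. n \<ge> N \<and> x \<in> ?I \<longrightarrow> norm (Y (k n) x - y x) < e"
  proof (rule Arzela_Ascoli[of ?I Y "norm y0 + M"])
    show "norm (Y n t) \<le> norm y0 + M" if "t \<in> ?I" for n t
      using near[OF that, of n] norm_triangle_sub[of "Y n t" y0] by simp
    show "\<exists>d. 0 < d \<and> (\<forall>n s. s \<in> ?I \<and> norm (t - s) < d \<longrightarrow> norm (Y n t - Y n s) < e)"
      if "t \<in> ?I" "0 < e" for t e
    \<comment> \<open>Dividing by \<open>M + 1\<close> rather than \<open>M\<close> covers the case
      \<open>M = 0\<close>.\<close>
    proof (intro exI[of _ "e / (M + 1)"] conjI allI impI)
      show "0 < e / (M + 1)" using that M by simp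
      fix n s assume s: "s \<in> ?I \<and> norm (t - s) < e / (M + 1)"
      have "norm (Y n t - Y n s) \<le> M * \<bar>t - s\<bar>" using Lip that s by blast
      also have "\<dots> \<le> (M + 1) * \<bar>t - s\<bar>" by (intro mult_right_mono) auto
      also have "\<dots> < e" using s M by (simp add: field_simps)
      finally show "norm (Y n t - Y n s) < e" .
    qed
  qed auto
  have limY: "uniform_limit ?I (\<lambda>n. Y (k n)) y sequentially"
    using conv unfolding uniform_limit_sequentially_iff dist_norm by meson
  have "h \<longlonglongrightarrow> 0" unfolding h_def by (rule LIMSEQ_Suc[OF lim_1_over_n])
  then have "(\<lambda>n. M * h (k n)) \<longlonglongrightarrow> M * 0"
    by (intro tendsto_mult tendsto_const) (use LIMSEQ_subseq_LIMSEQ[OF _ k] in \<open>auto simp: o_def\<close>)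
  then have hk: "(\<lambda>n. M * h (k n)) \<longlonglongrightarrow> 0" by simp
  have limYd: "uniform_limit ?I (\<lambda>n t. Y (k n) (d (k n) t)) y sequentially"
  proof (rule uniform_limitI)
    fix e :: real assume "0 < e"
    have "\<forall>\<^sub>F n in sequentially. M * h (k n) < e / 2"
      using order_tendstoD(2)[OF hk, of "e / 2"] \<open>0 < e\<close> by (meson half_gt_zero)
    moreover have "\<forall>\<^sub>F n in sequentially. \<forall>t\<in>?I. dist (Y (k n) t) (y t) < e / 2"
      using uniform_limitD[OF limY, of "e/2"] \<open>0 < e\<close> by simp
    ultimately show "\<forall>\<^sub>F n in sequentially. \<forall>t\<in>?I. dist (Y (k n) (d (k n) t)) (y t) < e"
    proof eventually_elim
      case (elim n)
      show ?case
      proof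
        fix t assume t: "t \<in> ?I"
        have "dist (Y (k n) (d (k n) t)) (Y (k n) t) \<le> M * \<bar>d (k n) t - t\<bar>"
          unfolding dist_norm by (rule Lip[OF dI[OF t] t])
        also have "\<dots> \<le> M * h (k n)" using dt M by (intro mult_left_mono) auto
        finally show "dist (Y (k n) (d (k n) t)) (y t) < e"
          using elim t dist_triangle[of "Y (k n) (d (k n) t)" "y t" "Y (k n) t"] by fastforce
      qed
    qed
  qed
  have limf: "uniform_limit ?I (\<lambda>n t. f (t, Y (k n) (d (k n) t))) (\<lambda>t. f (t, y t)) sequentially"
  proof (rule uniform_limit_compose_uniformly_continuous_on[where B = "?I \<times> cball y0 M"])
    show "uniform_limit ?I (\<lambda>n t. (t, Y (k n) (d (k n) t))) (\<lambda>t. (t, y t)) sequentially"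
      using limYd by (simp add: uniform_limit_iff dist_Pair_Pair)
    show "uniformly_continuous_on (?I \<times> cball y0 M) f"
      by (intro compact_uniformly_continuous compact_Times continuous_on_subset[OF cont]) auto
    show "\<forall>\<^sub>F n in sequentially. \<forall>t\<in>?I. (t, Y (k n) (d (k n) t)) \<in> ?I \<times> cball y0 M"
      using near[OF dI] by (intro always_eventually) (auto simp: dist_norm norm_minus_commute)
  qed (auto intro: closed_Times)
  \<comment> \<open>Uniform convergence of the derivatives and convergence at \<open>t0\<close>
    permit termwise differentiation. The limit \<open>g\<close> obtained this way is then identified
    with \<open>y\<close>.\<close>
  have "\<exists>g. \<forall>t\<in>?I. (\<lambda>n. Y (k n) t) \<longlonglongrightarrow> g t \<and>
      (g has_derivative (\<lambda>s. s *\<^sub>R f (t, y t))) (at t within ?I)"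
  proof (rule has_derivative_sequence)
    show "convex ?I" "t0 \<in> ?I" by auto
    show "(Y (k n) has_derivative (\<lambda>s. s *\<^sub>R f (t, Y (k n) (d (k n) t)))) (at t within ?I)"
      if "t \<in> ?I" for n t using Y[OF that] by (simp add: has_vector_derivative_def)
    show "(\<lambda>n. Y (k n) t0) \<longlonglongrightarrow> y0" by (simp add: Y0)
    fix e :: real assume "0 < e"
    have "\<forall>\<^sub>F n in sequentially. \<forall>t\<in>?I. dist (f (t, Y (k n) (d (k n) t))) (f (t, y t)) < e"
      using uniform_limitD[OF limf \<open>0 < e\<close>] .
    then show "\<forall>\<^sub>F n in sequentially. \<forall>t\<in>?I. \<forall>s. norm (s *\<^sub>R f (t, Y (k n) (d (k n) t)) - s *\<^sub>R f (t, y t)) \<le> e * norm s"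
    proof eventually_elim
      case (elim n)
      show ?case
      proof (intro ballI allI)
        fix t s assume "t \<in> ?I"
        then have "norm (f (t, Y (k n) (d (k n) t)) - f (t, y t)) \<le> e"
          using elim by (fastforce simp: dist_norm)
        then have "\<bar>s\<bar> * norm (f (t, Y (k n) (d (k n) t)) - f (t, y t)) \<le> \<bar>s\<bar> * e"
          by (intro mult_left_mono) auto
        then show "norm (s *\<^sub>R f (t, Y (k n) (d (k n) t)) - s *\<^sub>R f (t, y t)) \<le> e * norm s"
          by (simp add: mult.commute flip: scaleR_diff_right)
      qed
    qed
  qed
  then obtain g where g: "\<And>t. t \<in> ?I \<Longrightarrow> (\<lambda>n. Y (k n) t) \<longlonglongrightarrow> g t"
    "\<And>t. t \<in> ?I \<Longrightarrow> (g has_vector_derivative f (t, y t)) (at t within ?I)"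
    unfolding has_vector_derivative_def by blast
  have gy: "g t = y t" if "t \<in> ?I" for t
    using LIMSEQ_unique[OF g(1)[OF that] tendsto_uniform_limitI[OF limY that]] .
  have "g t0 = y0" using LIMSEQ_unique[OF g(1)[of t0]] by (simp add: Y0)
  with g(2) gy show ?thesis by (intro exI[of _ g]) auto
qed

text \<open>Composing \<open>F\<close> with the nearest-point projection onto a closed ball in
  \<open>V\<close> gives a bounded continuous field on the whole space. Its solution solves the
  original equation as long as its graph stays in the ball.\<close>

theorem Peano_existence:
  assumes V: "open V" and cont: "continuous_on V F" and in_V: "(t0, y0) \<in> V"
  shows "\<exists>I y. solves_ivp V F t0 y0 I y"
proof -
  obtain r where r: "0 < r" "cball (t0, y0) r \<subseteq> V"
    using open_contains_cball V in_V by blast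
  let ?B = "cball (t0, y0) r"
  have B: "convex ?B" "closed ?B" "?B \<noteq> {}" "compact ?B" using r(1) by auto
  define f where "f = (\<lambda>x. F (closest_point ?B x))"
  have FB: "continuous_on ?B F" using continuous_on_subset[OF cont r(2)] .
  have fcont: "continuous_on UNIV f"
    unfolding f_def
    by (rule continuous_on_compose2[OF FB continuous_on_closest_point])
       (use B closest_point_in_set[OF B(2,3)] in blast)+
  have "compact (F ` ?B)" using B FB compact_continuous_image by blast
  then obtain M where "\<And>x. x \<in> ?B \<Longrightarrow> norm (F x) \<le> M"
    by (meson compact_imp_bounded bounded_iff image_eqI)
  then have bound: "norm (f x) \<le> M" for x
    unfolding f_def using closest_point_in_set[OF B(2,3)] by blast
  let ?I = "{t0-1..t0+1}"
  obtain y where y0: "y t0 = y0"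
    and y: "\<And>t. t \<in> ?I \<Longrightarrow> (y has_vector_derivative f (t, y t)) (at t within ?I)"
    using Peano_existence_bounded[OF fcont bound, of t0 y0] by blast
  have y': "(y has_vector_derivative f (t, y t)) (at t)" if "t \<in> {t0-1<..<t0+1}" for t
    using y[of t] that by (simp add: at_within_Icc_at)
  have "isCont (\<lambda>t. (t, y t)) t0"
    using has_vector_derivative_continuous[OF y'[of t0]] by (intro continuous_intros) auto
  then have "\<forall>\<^sub>F t in nhds t0. dist (t, y t) (t0, y0) < r"
    using r(1) y0 unfolding isCont_def tendsto_iff eventually_at_filter
    by (auto elim!: eventually_mono)
  then obtain s where s: "0 < s" "\<And>t. \<bar>t - t0\<bar> < s \<Longrightarrow> dist (t, y t) (t0, y0) < r"
    by (auto simp: eventually_nhds_metric dist_real_def)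
  \<comment> \<open>The bound \<open>s\<close> keeps the graph in the ball, where \<open>f\<close>
    and \<open>F\<close> agree; the bound 1 keeps \<open>t\<close> in the interval on which
    \<open>y\<close> was constructed.\<close>
  define q where "q = min s 1"
  have q: "0 < q" "q \<le> s" "q \<le> 1" using s(1) by (auto simp: q_def)
  have "solves_ivp V F t0 y0 {t0-q<..<t0+q} y"
    unfolding solves_ivp_def
  proof (intro conjI ballI)
    fix t assume t: "t \<in> {t0-q<..<t0+q}"
    then have tB: "(t, y t) \<in> ?B" using s(2)[of t] q by (simp add: dist_commute abs_less_iff less_imp_le)
    then show "(t, y t) \<in> V" using r(2) by blast
    have "f (t, y t) = F (t, y t)" unfolding f_def using closest_point_self[OF tB] by simp
    then show "(y has_vector_derivative F (t, y t)) (at t)"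
      using y'[of t] t q by auto
  qed (use q y0 in \<open>auto simp: is_interval_convex_1\<close>)
  then show ?thesis by blast
qed

section \<open>Increment estimates from a modulus of continuity\<close>

text \<open>The segment is cut into \<open>N\<close> equal pieces of length at most \<sigma>, each
  contributing at most \<open>K * w \<sigma>\<close>, and \<open>N\<close> is at most
  \<open>\<bar>s\<bar> / \<sigma> + 1\<close>. Convexity keeps the division points in
  \<open>S\<close>. The result is affine in \<open>\<bar>s\<bar>\<close>, which is the form that
  Gronwall's inequality can use.\<close>

lemma modulus_chunk_bound:
  fixes G :: "'a::euclidean_space \<Rightarrow> 'b::euclidean_space"
  assumes S: "convex S"
    and G: "\<And>x s. x \<in> S \<Longrightarrow> x + s *\<^sub>R b \<in> S \<Longrightarrow> norm (G (x + s *\<^sub>R b) - G x) \<le> K * w \<bar>s\<bar>"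
    and K: "0 \<le> K" and w: "\<And>s. 0 \<le> s \<Longrightarrow> 0 \<le> w s" "mono_on {0..} w" and \<sigma>: "0 < \<sigma>"
    and x: "x \<in> S" "x + s *\<^sub>R b \<in> S"
  shows "norm (G (x + s *\<^sub>R b) - G x) \<le> K * (w \<sigma> / \<sigma>) * (\<bar>s\<bar> + \<sigma>)"
proof -
  define N where "N = nat \<lceil>\<bar>s\<bar> / \<sigma>\<rceil>"
  define h where "h = s / real N"
  have N: "\<bar>s\<bar> / \<sigma> \<le> real N" "real N \<le> \<bar>s\<bar> / \<sigma> + 1"
    unfolding N_def using \<sigma> by auto
  \<comment> \<open>If \<open>N = 0\<close> then \<open>s = 0\<close>, and \<open>h = 0\<close> by
    the convention for division by zero.\<close>
  have sN: "s = real N * h"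
    using N(1) \<sigma> by (cases "N = 0") (auto simp: h_def divide_le_0_iff)
  have h: "\<bar>h\<bar> \<le> \<sigma>"
    using N(1) \<sigma> by (cases "N = 0") (auto simp: h_def abs_divide field_simps)
  have mem: "x + (real k * h) *\<^sub>R b \<in> S" if "k \<le> N" for k
  proof (cases "N = 0")
    case False
    have "(1 - real k / real N) *\<^sub>R x + (real k / real N) *\<^sub>R (x + s *\<^sub>R b) \<in> S"
      using that False by (intro convexD[OF S x]) auto
    moreover have "(1 - real k / real N) *\<^sub>R x + (real k / real N) *\<^sub>R (x + s *\<^sub>R b)
        = x + (real k * h) *\<^sub>R b"
      by (simp add: h_def algebra_simps)
    ultimately show ?thesis by simp
  qed (use that x in auto)
  have "norm (G (x + (real k * h) *\<^sub>R b) - G x) \<le> real k * (K * w \<sigma>)" if "k \<le> N" for k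
    using that
  proof (induction k)
    case (Suc k)
    let ?x = "\<lambda>k::nat. x + (real k * h) *\<^sub>R b"
    have x': "?x (Suc k) = ?x k + h *\<^sub>R b" by (simp add: algebra_simps)
    have "norm (G (?x (Suc k)) - G (?x k)) \<le> K * w \<bar>h\<bar>"
      using G[of "?x k" h] mem[of k] mem[of "Suc k"] Suc.prems by (simp only: x')
    also have "\<dots> \<le> K * w \<sigma>"
      using h K \<sigma> by (intro mult_left_mono mono_onD[OF w(2)]) auto
    finally have "norm (G (?x (Suc k)) - G (?x k)) \<le> K * w \<sigma>" .
    moreover have "norm (G (?x (Suc k)) - G x) \<le> norm (G (?x (Suc k)) - G (?x k)) + norm (G (?x k) - G x)"
      using norm_triangle_ineq[of "G (?x (Suc k)) - G (?x k)" "G (?x k) - G x"] by simp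
    ultimately show ?case using Suc by (simp add: algebra_simps)
  qed simp
  from this[of N] have "norm (G (x + s *\<^sub>R b) - G x) \<le> real N * (K * w \<sigma>)"
    by (simp flip: sN)
  also have "\<dots> \<le> (\<bar>s\<bar> / \<sigma> + 1) * (K * w \<sigma>)"
    using N(2) K w(1)[of \<sigma>] \<sigma> by (intro mult_right_mono) auto
  also have "\<dots> = K * (w \<sigma> / \<sigma>) * (\<bar>s\<bar> + \<sigma>)"
    using \<sigma> by (simp add: field_simps)
  finally show ?thesis .
qed

text \<open>The path from \<open>x\<close> to \<open>y\<close> changes one coordinate at a time and
  never has to move along \<open>e\<close>. The point \<open>p T\<close> has the coordinates of
  \<open>y\<close> in \<open>T\<close> and those of \<open>x\<close> elsewhere; a box contains all
  such mixtures, which is why the domain is a box and not a ball.\<close>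

lemma cbox_coordinatewise_bound:
  fixes G :: "'a::euclidean_space \<Rightarrow> 'b::real_normed_vector"
  assumes G: "\<And>b x s. b \<in> Basis - {e} \<Longrightarrow> x \<in> cbox l u \<Longrightarrow> x + s *\<^sub>R b \<in> cbox l u \<Longrightarrow>
      norm (G (x + s *\<^sub>R b) - G x) \<le> L * (\<bar>s\<bar> + \<sigma>)"
    and L: "0 \<le> L" and \<sigma>: "0 \<le> \<sigma>" and x: "x \<in> cbox l u" and y: "y \<in> cbox l u" and e: "x \<bullet> e = y \<bullet> e"
  shows "norm (G y - G x) \<le> real DIM('a) * L * (norm (y - x) + \<sigma>)"
proof -
  define p where "p = (\<lambda>T. x + (\<Sum>b\<in>T. ((y - x) \<bullet> b) *\<^sub>R b))"
  have coord: "p T \<bullet> b = (if b \<in> T then y \<bullet> b else x \<bullet> b)"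
    if "T \<subseteq> Basis" "b \<in> Basis" for T b
  proof -
    have "(\<Sum>c\<in>T. ((y - x) \<bullet> c) * (c \<bullet> b)) = (\<Sum>c\<in>T. if c = b then (y - x) \<bullet> b else 0)"
      using that by (intro sum.cong) (auto simp: inner_Basis)
    also have "\<dots> = (if b \<in> T then (y - x) \<bullet> b else 0)"
      using that finite_subset[OF _ finite_Basis] by (subst sum.delta) auto
    finally show ?thesis by (simp add: p_def inner_left_distrib inner_sum_left inner_diff_left)
  qed
  have mem: "p T \<in> cbox l u" if "T \<subseteq> Basis" for T
    using x y coord[OF that] by (auto simp: mem_box)
  have "norm (G (p T) - G x) \<le> real (card T) * (L * (norm (y - x) + \<sigma>))"
    if "finite T" "T \<subseteq> Basis - {e}" for T
    using that
  proof (induction T rule: finite_induct)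
    case (insert b T)
    have step: "p (insert b T) = p T + ((y - x) \<bullet> b) *\<^sub>R b"
      using insert by (simp add: p_def algebra_simps)
    have "norm (G (p (insert b T)) - G (p T)) \<le> L * (\<bar>(y - x) \<bullet> b\<bar> + \<sigma>)"
      unfolding step
      by (intro G) (use mem[of T] mem[of "insert b T"] insert step in auto)
    also have "\<dots> \<le> L * (norm (y - x) + \<sigma>)"
      using L insert by (intro mult_left_mono add_right_mono Basis_le_norm) auto
    finally have "norm (G (p (insert b T)) - G (p T)) \<le> L * (norm (y - x) + \<sigma>)" .
    moreover have "norm (G (p (insert b T)) - G x)
        \<le> norm (G (p (insert b T)) - G (p T)) + norm (G (p T) - G x)"
      using norm_triangle_ineq[of "G (p (insert b T)) - G (p T)" "G (p T) - G x"] by simp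
    ultimately show ?case using insert by (simp add: algebra_simps)
  qed (simp add: p_def)
  from this[of "Basis - {e}"]
  have *: "norm (G (p (Basis - {e})) - G x) \<le> real (card (Basis - {e})) * (L * (norm (y - x) + \<sigma>))"
    by simp
  \<comment> \<open>The one coordinate left unchanged is that along \<open>e\<close>, where
    \<open>x\<close> and \<open>y\<close> agree.\<close>
  have "p (Basis - {e}) = y"
    by (rule euclidean_eqI) (use coord[of "Basis - {e}"] e in auto)
  with * have "norm (G y - G x) \<le> real (card (Basis - {e})) * (L * (norm (y - x) + \<sigma>))"
    by simp
  also have "\<dots> \<le> real DIM('a) * (L * (norm (y - x) + \<sigma>))"
    using L \<sigma> card_mono[OF finite_Basis, of "Basis - {e}"] by (intro mult_right_mono) auto
  finally show ?thesis by (simp add: mult.assoc)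
qed

section \<open>Gronwall inequalities and the limit hypothesis on the moduli\<close>

text \<open>To the right of \<open>t0\<close>, \<open>u\<close> times the decaying exponential is
  nonincreasing; to the left, the product with the opposite exponent is nondecreasing. The bound on
  the absolute value of \<open>u'\<close> supplies both signs.\<close>

lemma gronwall_two_sided:
  fixes u :: "real \<Rightarrow> real"
  assumes u: "\<And>t. \<bar>t - t0\<bar> < r \<Longrightarrow> (u has_real_derivative u' t) (at t)"
    and bound: "\<And>t. \<bar>t - t0\<bar> < r \<Longrightarrow> \<bar>u' t\<bar> \<le> B * u t"
    and t: "\<bar>t - t0\<bar> < r"
  shows "u t \<le> u t0 * exp (B * \<bar>t - t0\<bar>)"
proof (cases "t0 \<le> t")
  case True
  have "u t * exp (- B * (t - t0)) \<le> u t0 * exp (- B * (t0 - t0))"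
  proof (rule DERIV_nonpos_imp_nonincreasing[OF True])
    fix s assume s: "t0 \<le> s" "s \<le> t"
    then have s': "\<bar>s - t0\<bar> < r" using t by auto
    have "((\<lambda>s. u s * exp (- B * (s - t0))) has_real_derivative
        (u' s - B * u s) * exp (- B * (s - t0))) (at s)"
      by (auto intro!: derivative_eq_intros u[OF s'] simp: algebra_simps)
    moreover have "(u' s - B * u s) * exp (- B * (s - t0)) \<le> 0"
      using bound[OF s'] by (intro mult_nonpos_nonneg) auto
    ultimately show "\<exists>y. ((\<lambda>s. u s * exp (- B * (s - t0))) has_real_derivative y) (at s) \<and> y \<le> 0"
      by blast
  qed
  then have "u t * exp (- B * (t - t0)) * exp (B * (t - t0)) \<le> u t0 * exp (B * (t - t0))"
    by (intro mult_right_mono) auto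
  then have "u t \<le> u t0 * exp (B * (t - t0))"
    by (simp add: mult.assoc flip: exp_add)
  with True show ?thesis by simp
next
  case False
  have "u t * exp (B * (t - t0)) \<le> u t0 * exp (B * (t0 - t0))"
  proof (rule DERIV_nonneg_imp_nondecreasing[where f = "\<lambda>s. u s * exp (B * (s - t0))"])
    show "t \<le> t0" using False by simp
    fix s assume s: "t \<le> s" "s \<le> t0"
    then have s': "\<bar>s - t0\<bar> < r" using t by auto
    have "((\<lambda>s. u s * exp (B * (s - t0))) has_real_derivative
        (u' s + B * u s) * exp (B * (s - t0))) (at s)"
      by (auto intro!: derivative_eq_intros u[OF s'] simp: algebra_simps)
    moreover have "(u' s + B * u s) * exp (B * (s - t0)) \<ge> 0"
      using bound[OF s'] by (intro mult_nonneg_nonneg) auto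
    ultimately show "\<exists>y. ((\<lambda>s. u s * exp (B * (s - t0))) has_real_derivative y) (at s) \<and> y \<ge> 0"
      by blast
  qed
  then have "u t * exp (B * (t - t0)) \<le> u t0" by simp
  then have "u t * exp (B * (t - t0)) * exp (B * (t0 - t)) \<le> u t0 * exp (B * (t0 - t))"
    by (intro mult_right_mono) auto
  then have "u t \<le> u t0 * exp (B * (t0 - t))"
    by (simp add: mult.assoc flip: exp_add) (simp add: algebra_simps)
  with False show ?thesis by simp
qed

text \<open>The norm is not differentiable at 0, so Gronwall is applied to the smooth quantity
  \<open>u\<close>, the squared norm plus \<open>\<sigma>\<^sup>2\<close>. It starts at
  \<open>\<sigma>\<^sup>2\<close> and satisfies the bound with constant \<open>4 * A\<close>; the
  square root halves the exponent.\<close>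

lemma gronwall_perturbed:
  fixes D :: "real \<Rightarrow> 'a::euclidean_space"
  assumes D: "\<And>t. \<bar>t - t0\<bar> < r \<Longrightarrow> (D has_vector_derivative D' t) (at t)"
    and bound: "\<And>t. \<bar>t - t0\<bar> < r \<Longrightarrow> norm (D' t) \<le> A * (norm (D t) + \<sigma>)"
    and A: "0 \<le> A" and \<sigma>: "0 < \<sigma>" and D0: "D t0 = 0"
    and t: "\<bar>t - t0\<bar> < r"
  shows "norm (D t) \<le> \<sigma> * exp (2 * A * \<bar>t - t0\<bar>)"
proof -
  define u where "u = (\<lambda>t. D t \<bullet> D t + \<sigma>\<^sup>2)"
  have "u t \<le> u t0 * exp (4 * A * \<bar>t - t0\<bar>)"
  proof (rule gronwall_two_sided[OF _ _ t])
    fix s assume s: "\<bar>s - t0\<bar> < r"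
    show "(u has_real_derivative 2 * (D s \<bullet> D' s)) (at s)"
      unfolding u_def has_real_derivative_iff_has_vector_derivative has_vector_derivative_def
      using D[OF s, unfolded has_vector_derivative_def]
      by (auto intro!: derivative_eq_intros simp: inner_commute)
    have "\<bar>2 * (D s \<bullet> D' s)\<bar> \<le> 2 * (norm (D s) * norm (D' s))"
      using Cauchy_Schwarz_ineq2[of "D s" "D' s"] by simp
    also have "\<dots> \<le> 2 * (norm (D s) * (A * (norm (D s) + \<sigma>)))"
      using bound[OF s] by (intro mult_left_mono) auto
    also have "\<dots> = A * (2 * norm (D s) * (norm (D s) + \<sigma>))" by simp
    also have "\<dots> \<le> A * (4 * u s)"
    proof (rule mult_left_mono[OF _ A])
      \<comment> \<open>Completing the square gives the constant 4.\<close>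
      have "4 * u s - 2 * norm (D s) * (norm (D s) + \<sigma>)
          = (norm (D s) - \<sigma>)\<^sup>2 + (norm (D s))\<^sup>2 + 3 * \<sigma>\<^sup>2"
        unfolding u_def power2_norm_eq_inner[symmetric] by (simp add: power2_eq_square algebra_simps)
      also have "\<dots> \<ge> 0" by simp
      finally show "2 * norm (D s) * (norm (D s) + \<sigma>) \<le> 4 * u s" by simp
    qed
    finally show "\<bar>2 * (D s \<bullet> D' s)\<bar> \<le> 4 * A * u s"
      by (simp only: mult.assoc mult.left_commute[of A])
  qed
  then have "(norm (D t))\<^sup>2 \<le> \<sigma>\<^sup>2 * exp (4 * A * \<bar>t - t0\<bar>)"
    using D0 \<sigma> by (simp add: u_def flip: power2_norm_eq_inner) (smt (verit) zero_le_power2)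
  also have "4 * A * \<bar>t - t0\<bar> = 2 * (2 * A * \<bar>t - t0\<bar>)" by simp
  also have "\<sigma>\<^sup>2 * exp \<dots> = (\<sigma> * exp (2 * A * \<bar>t - t0\<bar>))\<^sup>2"
    by (simp only: exp_double power_mult_distrib)
  finally show ?thesis
    by (rule power2_le_imp_le) (use \<sigma> in simp)
qed

text \<open>Replacing \<open>w1\<close> and \<open>w2\<close> by their minimum makes the limit hypothesis
  control \<open>s * exp (w s / s)\<close> both where \<open>w1 s \<le> s\<close> and where \<open>s \<le> w1 s\<close>.\<close>

lemma min_modulus_exp_tendsto_0:
  fixes w1 w2 :: "real \<Rightarrow> real"
  assumes "((\<lambda>s. w1 s * exp (w2 s / s)) \<longlongrightarrow> 0) (at_right 0)"
  shows "((\<lambda>s. s * exp (min (w1 s) (w2 s) / s)) \<longlongrightarrow> 0) (at_right 0)"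
proof (rule tendsto_sandwich[where f = "\<lambda>_. 0" and h = "\<lambda>s. s * exp 1 + \<bar>w1 s * exp (w2 s / s)\<bar>"])
  have "((\<lambda>s. s * exp 1) \<longlongrightarrow> 0 * exp 1) (at_right (0::real))"
    by (intro tendsto_intros)
  then have "((\<lambda>s. s * exp 1 + \<bar>w1 s * exp (w2 s / s)\<bar>) \<longlongrightarrow> 0 + 0) (at_right 0)"
    using assms by (intro tendsto_add) (auto intro: tendsto_rabs_zero)
  then show "((\<lambda>s. s * exp 1 + \<bar>w1 s * exp (w2 s / s)\<bar>) \<longlongrightarrow> 0) (at_right 0)" by simp
  show "\<forall>\<^sub>F s in at_right 0. s * exp (min (w1 s) (w2 s) / s) \<le> s * exp 1 + \<bar>w1 s * exp (w2 s / s)\<bar>"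
    using eventually_at_right_less[of 0]
  proof eventually_elim
    case (elim s)
    show ?case
    proof (cases "w1 s \<le> s")
      case True
      then have "min (w1 s) (w2 s) / s \<le> 1" using elim by (simp add: divide_le_eq)
      then have "s * exp (min (w1 s) (w2 s) / s) \<le> s * exp 1" using elim by simp
      then show ?thesis by simp
    next
      case False
      have "s * exp (min (w1 s) (w2 s) / s) \<le> w1 s * exp (w2 s / s)"
        using elim False by (intro mult_mono) (auto intro!: divide_right_mono)
      also have "\<dots> \<le> \<bar>w1 s * exp (w2 s / s)\<bar>" by simp
      finally show ?thesis using elim by (smt (verit) exp_gt_zero mult_pos_pos)
    qed
  qed
  show "\<forall>\<^sub>F s in at_right 0. 0 \<le> s * exp (min (w1 s) (w2 s) / s)"
    using eventually_at_right_less[of 0] by eventually_elim simp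
qed auto

section \<open>Integral curves parametrized by a coordinate\<close>

text \<open>The difference splits into a change of the vector and a change of the scalar factor. The
  lower bound \<open>c\<close> on the \<open>e\<close>-components turns these into the terms
  \<open>1 / c\<close> and \<open>M / c\<^sup>2\<close>.\<close>

lemma normalized_field_bound:
  fixes G :: "'a::euclidean_space \<Rightarrow> 'a"
  assumes e: "norm e = 1"
    and c: "0 < c" "c \<le> \<bar>G x \<bullet> e\<bar>" "c \<le> \<bar>G y \<bullet> e\<bar>" and M: "norm (G x) \<le> M"
  shows "norm (inverse (G y \<bullet> e) *\<^sub>R G y - inverse (G x \<bullet> e) *\<^sub>R G x)
    \<le> (1 / c + M / c\<^sup>2) * norm (G y - G x)"
proof -
  let ?a = "G x \<bullet> e" and ?b = "G y \<bullet> e"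
  have nz: "?a \<noteq> 0" "?b \<noteq> 0" using c by auto
  have "inverse ?b *\<^sub>R G y - inverse ?a *\<^sub>R G x
      = inverse ?b *\<^sub>R (G y - G x) + (inverse ?b - inverse ?a) *\<^sub>R G x"
    by (simp add: algebra_simps)
  also have "norm \<dots> \<le> \<bar>inverse ?b\<bar> * norm (G y - G x) + \<bar>inverse ?b - inverse ?a\<bar> * norm (G x)"
    by (metis norm_scaleR norm_triangle_ineq)
  also have "\<dots> \<le> (1 / c) * norm (G y - G x) + (norm (G y - G x) / c\<^sup>2) * M"
  proof (intro add_mono mult_mono)
    show "\<bar>inverse ?b\<bar> \<le> 1 / c"
      using c by (simp add: abs_inverse divide_simps)
    have "\<bar>inverse ?b - inverse ?a\<bar> = \<bar>(G y - G x) \<bullet> e\<bar> / (\<bar>?a\<bar> * \<bar>?b\<bar>)"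
      using nz by (simp add: inverse_diff_inverse abs_mult abs_inverse inner_diff_left divide_inverse
        abs_minus_commute mult.commute mult.left_commute)
    also have "\<dots> \<le> norm (G y - G x) / (c * c)"
    proof (rule frac_le)
      show "\<bar>(G y - G x) \<bullet> e\<bar> \<le> norm (G y - G x)"
        using Cauchy_Schwarz_ineq2[of "G y - G x" e] e by simp
      show "c * c \<le> \<bar>?a\<bar> * \<bar>?b\<bar>" using c by (intro mult_mono) auto
    qed (use c in auto)
    finally show "\<bar>inverse ?b - inverse ?a\<bar> \<le> norm (G y - G x) / c\<^sup>2"
      by (simp add: power2_eq_square)
  qed (use c M in auto)
  finally show ?thesis by (simp add: algebra_simps)
qed

text \<open>The coordinate of \<open>X\<close> along \<open>e\<close> has nonvanishing derivative,
  hence a local inverse \<tau>, and the chain rule divides the velocity by its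
  \<open>e\<close>-component. The last conclusion makes it possible to return from the coordinate to
  the time.\<close>

lemma reparametrize_by_coordinate:
  fixes X :: "real \<Rightarrow> 'a::euclidean_space"
  assumes r: "0 < r"
    and X: "\<And>t. \<bar>t - t0\<bar> < r \<Longrightarrow> (X has_vector_derivative G (X t)) (at t)"
    and nz: "\<And>t. \<bar>t - t0\<bar> < r \<Longrightarrow> G (X t) \<bullet> e \<noteq> 0"
  obtains \<delta> \<tau> where "0 < \<delta>" "\<tau> (X t0 \<bullet> e) = t0"
    "\<And>p. \<bar>p - X t0 \<bullet> e\<bar> < \<delta> \<Longrightarrow> \<bar>\<tau> p - t0\<bar> < r \<and> X (\<tau> p) \<bullet> e = p \<and>
       ((X \<circ> \<tau>) has_vector_derivative inverse (G (X (\<tau> p)) \<bullet> e) *\<^sub>R G (X (\<tau> p))) (at p)"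
    "\<And>t. \<bar>t - t0\<bar> < r \<Longrightarrow> \<tau> (X t \<bullet> e) = t"
proof -
  let ?S = "ball t0 r"
  have S: "t \<in> ?S \<longleftrightarrow> \<bar>t - t0\<bar> < r" for t by (simp add: dist_real_def abs_minus_commute)
  define q where "q = (\<lambda>t. X t \<bullet> e)"
  have q: "(q has_real_derivative G (X t) \<bullet> e) (at t)" if "t \<in> ?S" for t
    unfolding q_def has_real_derivative_iff_has_vector_derivative
    by (rule bounded_linear.has_vector_derivative[OF bounded_linear_inner_left X])
       (use that S in auto)
  have qcont: "continuous_on ?S q"
    using q DERIV_isCont continuous_at_imp_continuous_on by blast
  have qinj: "inj_on q ?S"
  \<comment> \<open>Equal values at two points would give, by the mean value theorem, a zero of the
    derivative in between.\<close>
  proof (rule linorder_inj_onI)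
    fix a b assume ab: "a < b" "a \<in> ?S" "b \<in> ?S"
    have sub: "t \<in> ?S" if "a \<le> t" "t \<le> b" for t using that ab S by auto
    obtain z where "a < z" "z < b" "q b - q a = (b - a) * (G (X z) \<bullet> e)"
      using MVT2[OF ab(1), of q "\<lambda>t. G (X t) \<bullet> e"] q sub by blast
    then show "q a \<noteq> q b" using nz[of z] sub[of z] S ab(1) by auto
  qed auto
  \<comment> \<open>Invariance of domain provides an open image and a continuous inverse;
    differentiability of the inverse follows from these below.\<close>
  obtain \<tau> where hom: "homeomorphism ?S (q ` ?S) q \<tau>"
    using invariance_of_domain_homeomorphism[OF _ qcont _ qinj] by auto
  have op: "open (q ` ?S)" using invariance_of_domain[OF qcont _ qinj] by simp
  have t0: "t0 \<in> ?S" using r by simp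
  then obtain \<delta> where \<delta>: "0 < \<delta>" "ball (q t0) \<delta> \<subseteq> q ` ?S"
    using op open_contains_ball by (metis imageI)
  show ?thesis
  proof (rule that[OF \<delta>(1), of \<tau>])
    show left: "\<tau> (X t \<bullet> e) = t" if "\<bar>t - t0\<bar> < r" for t
      using homeomorphism_apply1[OF hom, of t] that S by (simp add: q_def)
    show "\<tau> (X t0 \<bullet> e) = t0" using left r by simp
    fix p assume "\<bar>p - X t0 \<bullet> e\<bar> < \<delta>"
    then have p: "p \<in> q ` ?S" using \<delta>(2) by (auto simp: q_def dist_real_def abs_minus_commute)
    then have \<tau>p: "\<tau> p \<in> ?S" using hom by (auto simp: homeomorphism_def)
    have inv: "q (\<tau> z) = z" if "z \<in> q ` ?S" for z using homeomorphism_apply2[OF hom that] .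
    have "continuous_on (q ` ?S) \<tau>" using hom by (simp add: homeomorphism_def)
    then have "isCont \<tau> p" using op p continuous_on_eq_continuous_at by blast
    then have "(\<tau> has_real_derivative inverse (G (X (\<tau> p)) \<bullet> e)) (at p)"
      using has_field_derivative_inverse_basic[OF q[OF \<tau>p] _ _ op p inv] nz \<tau>p S by blast
    then have "((X \<circ> \<tau>) has_vector_derivative inverse (G (X (\<tau> p)) \<bullet> e) *\<^sub>R G (X (\<tau> p))) (at p)"
      using vector_diff_chain_at[of \<tau> _ p X "G (X (\<tau> p))"] X \<tau>p S
      by (simp add: has_real_derivative_iff_has_vector_derivative)
    then show "\<bar>\<tau> p - t0\<bar> < r \<and> X (\<tau> p) \<bullet> e = p \<and>
       ((X \<circ> \<tau>) has_vector_derivative inverse (G (X (\<tau> p)) \<bullet> e) *\<^sub>R G (X (\<tau> p))) (at p)"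
      using inv[OF p] \<tau>p S by (auto simp: q_def)
  qed
qed

text \<open>At equal parameters both curves have the same coordinate along \<open>e\<close>, so only
  increments in the other directions, controlled by \<open>w\<close>, enter the difference of their
  velocities. Gronwall then applies for every \<sigma> on one fixed interval, and \<sigma> tends to
  0.\<close>

lemma normalized_curves_coincide:
  fixes G :: "'a::euclidean_space \<Rightarrow> 'a"
  assumes e: "e \<in> Basis" and V: "open V" "\<xi> \<in> V" and cont: "continuous_on V G"
    and nz: "G \<xi> \<bullet> e \<noteq> 0"
    and G: "\<And>b x s. b \<in> Basis - {e} \<Longrightarrow> x \<in> V \<Longrightarrow> x + s *\<^sub>R b \<in> V \<Longrightarrow>
      norm (G (x + s *\<^sub>R b) - G x) \<le> K * w \<bar>s\<bar>"
    and K: "0 \<le> K" and w: "\<And>s. 0 \<le> s \<Longrightarrow> 0 \<le> w s" "mono_on {0..} w"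
    and lim: "((\<lambda>s. s * exp (w s / s)) \<longlongrightarrow> 0) (at_right 0)"
    and \<delta>: "0 < \<delta>" and start: "Y p0 = \<xi>" "Z p0 = \<xi>"
    and Y: "\<And>p. \<bar>p - p0\<bar> < \<delta> \<Longrightarrow>
      Y p \<bullet> e = p \<and> (Y has_vector_derivative inverse (G (Y p) \<bullet> e) *\<^sub>R G (Y p)) (at p)"
    and Z: "\<And>p. \<bar>p - p0\<bar> < \<delta> \<Longrightarrow>
      Z p \<bullet> e = p \<and> (Z has_vector_derivative inverse (G (Z p) \<bullet> e) *\<^sub>R G (Z p)) (at p)"
  shows "\<forall>\<^sub>F p in nhds p0. Y p = Z p"
proof -
  \<comment> \<open>Half the value at \<xi> makes the strict lower bound an open condition that
    holds at \<xi>.\<close>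
  define c where "c = \<bar>G \<xi> \<bullet> e\<bar> / 2"
  have c: "0 < c" using nz by (simp add: c_def)
  have "open (V \<inter> (\<lambda>x. \<bar>G x \<bullet> e\<bar>) -` {c<..})"
    using cont V by (intro continuous_open_preimage continuous_intros) auto
  moreover have "\<xi> \<in> V \<inter> (\<lambda>x. \<bar>G x \<bullet> e\<bar>) -` {c<..}"
    using V nz by (simp add: c_def)
  ultimately obtain l u where box: "cbox l u \<subseteq> V \<inter> (\<lambda>x. \<bar>G x \<bullet> e\<bar>) -` {c<..}" "\<xi> \<in> box l u"
    by (rule open_contains_cbox) blast
  have "compact (G ` cbox l u)"
    using box(1) by (intro compact_continuous_image continuous_on_subset[OF cont]) auto
  then obtain M where M: "0 < M" "\<And>x. x \<in> cbox l u \<Longrightarrow> norm (G x) \<le> M"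
    by (metis compact_imp_bounded bounded_pos image_eqI)
  define H where "H = (\<lambda>x. inverse (G x \<bullet> e) *\<^sub>R G x)"
  \<comment> \<open>The first factor is the cost of normalizing the field, the second that of the
    coordinatewise path. Neither involves \<sigma>.\<close>
  define C where "C = (1 / c + M / c\<^sup>2) * (real DIM('a) * K)"
  have C: "0 \<le> C" using c M K by (simp add: C_def)
  have H: "norm (H x - H y) \<le> C * (w \<sigma> / \<sigma>) * (norm (x - y) + \<sigma>)"
    if x: "x \<in> cbox l u" "y \<in> cbox l u" "x \<bullet> e = y \<bullet> e" and \<sigma>: "0 < \<sigma>" for x y \<sigma>
  proof -
    have "norm (G x - G y) \<le> real DIM('a) * (K * (w \<sigma> / \<sigma>)) * (norm (x - y) + \<sigma>)"
    proof (rule cbox_coordinatewise_bound)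
      fix b z s assume b: "b \<in> Basis - {e}" and z: "z \<in> cbox l u" "z + s *\<^sub>R b \<in> cbox l u"
      have "norm (G (x + s *\<^sub>R b) - G x) \<le> K * w \<bar>s\<bar>"
        if "x \<in> cbox l u" "x + s *\<^sub>R b \<in> cbox l u" for x s
        using G[OF b] that box(1) by blast
      then show "norm (G (z + s *\<^sub>R b) - G z) \<le> K * (w \<sigma> / \<sigma>) * (\<bar>s\<bar> + \<sigma>)"
        using modulus_chunk_bound[OF convex_box(1) _ K w \<sigma> z] by blast
    qed (use x K w \<sigma> in auto)
    moreover have "norm (H x - H y) \<le> (1 / c + M / c\<^sup>2) * norm (G x - G y)"
      unfolding H_def using box(1) x c M e by (intro normalized_field_bound) force+
    ultimately have "norm (H x - H y) \<le> (1 / c + M / c\<^sup>2) *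
        (real DIM('a) * (K * (w \<sigma> / \<sigma>)) * (norm (x - y) + \<sigma>))"
      using c M by (meson add_nonneg_nonneg divide_nonneg_nonneg less_imp_le mult_left_mono
          order_trans zero_le_one zero_le_power2)
    then show ?thesis by (simp add: C_def mult.assoc)
  qed
  have near: "\<forall>\<^sub>F p in nhds p0. W p \<in> box l u"
    if "W p0 = \<xi>" "(W has_vector_derivative v) (at p0)" for W v
  proof -
    have "(W \<longlongrightarrow> \<xi>) (at p0)"
      using has_vector_derivative_continuous[OF that(2)] that(1) by (simp add: isCont_def)
    then have "\<forall>\<^sub>F p in at p0. W p \<in> box l u"
      using topological_tendstoD open_box box(2) by blast
    then show ?thesis using that(1) box(2) by (auto simp: eventually_at_filter elim: eventually_mono)
  qed
  have "\<forall>\<^sub>F p in nhds p0. Y p \<in> box l u \<and> Z p \<in> box l u"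
    using near[of Y, OF start(1)] near[of Z, OF start(2)] Y[of p0] Z[of p0] \<delta>
    by (intro eventually_conj) auto
  then obtain r where r: "0 < r" "\<And>p. \<bar>p - p0\<bar> < r \<Longrightarrow> Y p \<in> cbox l u \<and> Z p \<in> cbox l u"
    unfolding eventually_nhds_metric dist_real_def using box_subset_cbox by blast
  \<comment> \<open>The bound \<open>1 / (2 * C + 1)\<close> ensures
    \<open>2 * C * q \<le> 1\<close>, so that the Gronwall exponent is at most
    \<open>w \<sigma> / \<sigma>\<close>; the added 1 covers \<open>C = 0\<close>. The radius is
    fixed before \<sigma> is chosen.\<close>
  define q where "q = min (min \<delta> r) (1 / (2 * C + 1))"
  have q: "0 < q" "q \<le> \<delta>" "q \<le> r" "q \<le> 1 / (2 * C + 1)"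
    using \<delta> r(1) C by (auto simp: q_def)
  have Cq: "2 * C * q \<le> 1"
  proof -
    have "q * (2 * C + 1) \<le> 1" using q(4) C by (simp add: le_divide_eq)
    then show ?thesis using q(1) by (simp add: algebra_simps)
  qed
  have "Y p = Z p" if p: "\<bar>p - p0\<bar> < q" for p
  proof -
    have "norm (Y p - Z p) \<le> \<sigma> * exp (w \<sigma> / \<sigma>)" if \<sigma>: "0 < \<sigma>" for \<sigma>
    proof -
      have "norm (Y p - Z p) \<le> \<sigma> * exp (2 * (C * (w \<sigma> / \<sigma>)) * \<bar>p - p0\<bar>)"
      proof (rule gronwall_perturbed[where D' = "\<lambda>t. H (Y t) - H (Z t)"])
        fix t assume t: "\<bar>t - p0\<bar> < q"
        show "((\<lambda>t. Y t - Z t) has_vector_derivative H (Y t) - H (Z t)) (at t)"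
          unfolding H_def using Y Z t q by (intro has_vector_derivative_diff) auto
        show "norm (H (Y t) - H (Z t)) \<le> C * (w \<sigma> / \<sigma>) * (norm (Y t - Z t) + \<sigma>)"
          using t q Y[of t] Z[of t] r(2)[of t] \<sigma> by (intro H) auto
      qed (use C w \<sigma> start p in auto)
      also have "2 * (C * (w \<sigma> / \<sigma>)) * \<bar>p - p0\<bar> = (2 * C * \<bar>p - p0\<bar>) * (w \<sigma> / \<sigma>)" by simp
      also have "\<sigma> * exp \<dots> \<le> \<sigma> * exp (1 * (w \<sigma> / \<sigma>))"
      proof -
        have "2 * C * \<bar>p - p0\<bar> \<le> 2 * C * q" using p C by (intro mult_left_mono) auto
        then have "(2 * C * \<bar>p - p0\<bar>) * (w \<sigma> / \<sigma>) \<le> 1 * (w \<sigma> / \<sigma>)"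
          using Cq w(1)[of \<sigma>] \<sigma> by (intro mult_right_mono) auto
        then show ?thesis using \<sigma> by simp
      qed
      finally show ?thesis by simp
    qed
    then have "\<forall>\<^sub>F \<sigma> in at_right 0. norm (Y p - Z p) \<le> \<sigma> * exp (w \<sigma> / \<sigma>)"
      using eventually_at_right_less[of "0::real"] by (auto elim: eventually_mono)
    then have "norm (Y p - Z p) \<le> 0"
      by (intro tendsto_lowerbound[OF lim]) auto
    then show ?thesis by simp
  qed
  then show ?thesis
    unfolding eventually_nhds_metric dist_real_def using q(1) by blast
qed

section \<open>From the ODE to the extended field, and uniqueness\<close>

text \<open>The first component of the extended field is constant, so its increments have the same
  norm as those of \<open>F\<close>. Along directions in \<open>B\<close> they therefore obey both
  moduli, hence the smaller one.\<close>

lemma common_modulus_bound: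
  fixes F :: "real \<times> (real ^ 'n) \<Rightarrow> real ^ 'n"
  assumes w: "modulus_function w1" "modulus_function w2"
    and F: "has_modulus F V w1"
    and G: "\<And>b. b \<in> B \<Longrightarrow> has_modulus_wrt (extended_field F) V w2 b"
    and B: "B \<subseteq> Basis"
  obtains K where "0 \<le> K" "\<And>b x s. b \<in> B \<Longrightarrow> x \<in> V \<Longrightarrow> x + s *\<^sub>R b \<in> V \<Longrightarrow>
      norm (extended_field F (x + s *\<^sub>R b) - extended_field F x) \<le> K * min (w1 \<bar>s\<bar>) (w2 \<bar>s\<bar>)"
proof -
  have pos: "0 \<le> w1 \<bar>s\<bar>" "0 \<le> w2 \<bar>s\<bar>" for s using w by (auto simp: modulus_function_def)
  have "\<exists>K>0. \<forall>x\<in>V. \<forall>s. x + s *\<^sub>R b \<in> V \<longrightarrow>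
      norm (extended_field F (x + s *\<^sub>R b) - extended_field F x) \<le> K * min (w1 \<bar>s\<bar>) (w2 \<bar>s\<bar>)"
    if b: "b \<in> B" for b
  proof -
    obtain K1 where K1: "K1 > 0" "\<And>x s. x \<in> V \<Longrightarrow> x + s *\<^sub>R b \<in> V \<Longrightarrow>
        norm (F (x + s *\<^sub>R b) - F x) \<le> K1 * w1 \<bar>s\<bar>"
      using F b B unfolding has_modulus_def has_modulus_wrt_def by blast
    obtain K2 where K2: "K2 > 0" "\<And>x s. x \<in> V \<Longrightarrow> x + s *\<^sub>R b \<in> V \<Longrightarrow>
        norm (extended_field F (x + s *\<^sub>R b) - extended_field F x) \<le> K2 * w2 \<bar>s\<bar>"
      using G[OF b] unfolding has_modulus_wrt_def by blast
    have "norm (extended_field F (x + s *\<^sub>R b) - extended_field F x)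
        \<le> max K1 K2 * min (w1 \<bar>s\<bar>) (w2 \<bar>s\<bar>)" if "x \<in> V" "x + s *\<^sub>R b \<in> V" for x s
    proof -
      have "norm (extended_field F (x + s *\<^sub>R b) - extended_field F x) = norm (F (x + s *\<^sub>R b) - F x)"
        by (simp add: extended_field_def norm_Pair)
      moreover have "K1 * w1 \<bar>s\<bar> \<le> max K1 K2 * w1 \<bar>s\<bar>" "K2 * w2 \<bar>s\<bar> \<le> max K1 K2 * w2 \<bar>s\<bar>"
        using pos by (auto intro: mult_right_mono)
      ultimately show ?thesis using K1(2)[OF that] K2(2)[OF that] by (simp add: min_def)
    qed
    then show ?thesis using K1(1) by (intro exI[of _ "max K1 K2"]) auto
  qed
  then obtain K where K: "\<And>b. b \<in> B \<Longrightarrow> 0 < K b"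
    "\<And>b x s. b \<in> B \<Longrightarrow> x \<in> V \<Longrightarrow> x + s *\<^sub>R b \<in> V \<Longrightarrow>
      norm (extended_field F (x + s *\<^sub>R b) - extended_field F x) \<le> K b * min (w1 \<bar>s\<bar>) (w2 \<bar>s\<bar>)"
    by metis
  show ?thesis
  \<comment> \<open>Summing the finitely many constants gives one that serves all
    directions.\<close>
  proof (rule that[of "sum K B"])
    show "0 \<le> sum K B" using K(1) by (intro sum_nonneg) (simp add: less_imp_le)
    fix b x s assume *: "b \<in> B" "x \<in> V" "x + s *\<^sub>R b \<in> V"
    have "K b \<le> sum K B"
      using *(1) K(1) finite_subset[OF B finite_Basis] by (intro member_le_sum) (auto simp: less_imp_le)
    then have "K b * min (w1 \<bar>s\<bar>) (w2 \<bar>s\<bar>) \<le> sum K B * min (w1 \<bar>s\<bar>) (w2 \<bar>s\<bar>)"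
      using pos by (intro mult_right_mono) auto
    with K(2)[OF *] show "norm (extended_field F (x + s *\<^sub>R b) - extended_field F x)
        \<le> sum K B * min (w1 \<bar>s\<bar>) (w2 \<bar>s\<bar>)" by linarith
  qed
qed

text \<open>The graph of a solution is an integral curve of the autonomous extended field. By
  continuity the \<open>e\<close>-component of the field remains nonzero along it near
  \<open>t0\<close>.\<close>

lemma solves_ivp_extended_curve:
  assumes sol: "solves_ivp V F t0 y0 I y" and V: "open V" and cont: "continuous_on V F"
    and nz: "extended_field F (t0, y0) \<bullet> e \<noteq> 0"
  obtains r where "0 < r"
    "\<And>t. \<bar>t - t0\<bar> < r \<Longrightarrow> ((\<lambda>t. (t, y t)) has_vector_derivative extended_field F (t, y t)) (at t)"
    "\<And>t. \<bar>t - t0\<bar> < r \<Longrightarrow> extended_field F (t, y t) \<bullet> e \<noteq> 0"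
proof -
  have I: "open I" "t0 \<in> I" "y t0 = y0"
    and y: "\<And>t. t \<in> I \<Longrightarrow> (t, y t) \<in> V \<and> (y has_vector_derivative F (t, y t)) (at t)"
    using sol by (auto simp: solves_ivp_def)
  have X: "((\<lambda>t. (t, y t)) has_vector_derivative extended_field F (t, y t)) (at t)" if "t \<in> I" for t
    unfolding extended_field_def using y[OF that]
    by (intro has_vector_derivative_Pair) auto
  have Xcont: "continuous_on I (\<lambda>t. (t, y t))"
    using X has_vector_derivative_continuous continuous_at_imp_continuous_on by blast
  have "continuous_on V (extended_field F)"
    unfolding extended_field_def[abs_def] using cont by (intro continuous_intros)
  then have "continuous_on I (\<lambda>t. extended_field F (t, y t))"
    by (rule continuous_on_compose2[OF _ Xcont]) (use y in auto)
  then have "continuous_on I (\<lambda>t. extended_field F (t, y t) \<bullet> e)"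
    by (intro continuous_intros)
  then have "open (I \<inter> (\<lambda>t. extended_field F (t, y t) \<bullet> e) -` (- {0}))"
    using I by (intro continuous_open_preimage) auto
  moreover have "t0 \<in> I \<inter> (\<lambda>t. extended_field F (t, y t) \<bullet> e) -` (- {0})" using I nz by auto
  ultimately obtain r where "0 < r" "ball t0 r \<subseteq> I \<inter> (\<lambda>t. extended_field F (t, y t) \<bullet> e) -` (- {0})"
    using open_contains_ball by blast
  then show ?thesis using X by (intro that[of r]) (auto simp: subset_eq dist_real_def abs_minus_commute)
qed

theorem theorem1:
  fixes V :: "(real \<times> (real ^ 'n)) set"
    and F :: "real \<times> (real ^ 'n) \<Rightarrow> (real ^ 'n)"
    and w1 w2 :: "real \<Rightarrow> real"
    and t0 :: real and y0 :: "real ^ 'n"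
    and e :: "real \<times> (real ^ 'n)"
  assumes "modulus_function w1" and "modulus_function w2"
    and "open V"
    and "continuous_on V F"
    and "has_modulus F V w1"
    and "(t0, y0) \<in> V"
    and "e \<in> Basis"
    and "extended_field F (t0, y0) \<bullet> e \<noteq> 0"
    and "\<And>e'. e' \<in> Basis - {e} \<Longrightarrow> has_modulus_wrt (extended_field F) V w2 e'"
    and "((\<lambda>s. w1 s * exp (w2 s / s)) \<longlongrightarrow> 0) (at_right 0)"
  shows "unique_local_solution V F t0 y0"
  unfolding unique_local_solution_def
proof (intro conjI allI impI)
  show "\<exists>I y. solves_ivp V F t0 y0 I y" using Peano_existence assms(3,4,6) .
  fix I y J z assume sol: "solves_ivp V F t0 y0 I y" "solves_ivp V F t0 y0 J z"
  define G where "G = extended_field F"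
  define w where "w = (\<lambda>s. min (w1 s) (w2 s))"
  define p0 where "p0 = (t0, y0) \<bullet> e"
  have init: "y t0 = y0" "z t0 = y0" using sol by (auto simp: solves_ivp_def)
  have Gcont: "continuous_on V G"
    unfolding G_def extended_field_def[abs_def] using assms(4) by (intro continuous_intros)
  have w: "\<And>s. 0 \<le> s \<Longrightarrow> 0 \<le> w s" "mono_on {0..} w"
    using assms(1,2) unfolding modulus_function_def w_def by (auto simp: mono_on_def min_le_iff_disj)
  have lim: "((\<lambda>s. s * exp (w s / s)) \<longlongrightarrow> 0) (at_right 0)"
    unfolding w_def by (rule min_modulus_exp_tendsto_0[OF assms(10)])
  obtain K where K: "0 \<le> K" "\<And>b x s. b \<in> Basis - {e} \<Longrightarrow> x \<in> V \<Longrightarrow> x + s *\<^sub>R b \<in> V \<Longrightarrow>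
      norm (G (x + s *\<^sub>R b) - G x) \<le> K * w \<bar>s\<bar>"
    unfolding G_def w_def
    using common_modulus_bound[OF assms(1,2,5), of "Basis - {e}"] assms(9) by auto
  define X1 where "X1 = (\<lambda>t. (t, y t))"
  define X2 where "X2 = (\<lambda>t. (t, z t))"
  have X0: "X1 t0 \<bullet> e = p0" "X2 t0 \<bullet> e = p0" "X1 t0 = (t0, y0)" "X2 t0 = (t0, y0)"
    using init by (auto simp: X1_def X2_def p0_def)
  obtain r1 where r1: "0 < r1"
    "\<And>t. \<bar>t - t0\<bar> < r1 \<Longrightarrow> (X1 has_vector_derivative G (X1 t)) (at t)"
    "\<And>t. \<bar>t - t0\<bar> < r1 \<Longrightarrow> G (X1 t) \<bullet> e \<noteq> 0"
    unfolding G_def X1_def using solves_ivp_extended_curve[OF sol(1) assms(3,4,8)] by blast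
  obtain r2 where r2: "0 < r2"
    "\<And>t. \<bar>t - t0\<bar> < r2 \<Longrightarrow> (X2 has_vector_derivative G (X2 t)) (at t)"
    "\<And>t. \<bar>t - t0\<bar> < r2 \<Longrightarrow> G (X2 t) \<bullet> e \<noteq> 0"
    unfolding G_def X2_def using solves_ivp_extended_curve[OF sol(2) assms(3,4,8)] by blast
  obtain d1 \<tau>1 where \<tau>1: "0 < d1" "\<tau>1 p0 = t0"
    "\<And>p. \<bar>p - p0\<bar> < d1 \<Longrightarrow> \<bar>\<tau>1 p - t0\<bar> < r1 \<and> X1 (\<tau>1 p) \<bullet> e = p \<and>
       ((X1 \<circ> \<tau>1) has_vector_derivative inverse (G (X1 (\<tau>1 p)) \<bullet> e) *\<^sub>R G (X1 (\<tau>1 p))) (at p)"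
    "\<And>t. \<bar>t - t0\<bar> < r1 \<Longrightarrow> \<tau>1 (X1 t \<bullet> e) = t"
    by (rule reparametrize_by_coordinate[of r1 t0 X1 G e, OF r1, unfolded X0(1)]) blast+
  obtain d2 \<tau>2 where \<tau>2: "0 < d2" "\<tau>2 p0 = t0"
    "\<And>p. \<bar>p - p0\<bar> < d2 \<Longrightarrow> \<bar>\<tau>2 p - t0\<bar> < r2 \<and> X2 (\<tau>2 p) \<bullet> e = p \<and>
       ((X2 \<circ> \<tau>2) has_vector_derivative inverse (G (X2 (\<tau>2 p)) \<bullet> e) *\<^sub>R G (X2 (\<tau>2 p))) (at p)"
    "\<And>t. \<bar>t - t0\<bar> < r2 \<Longrightarrow> \<tau>2 (X2 t \<bullet> e) = t"
    by (rule reparametrize_by_coordinate[of r2 t0 X2 G e, OF r2, unfolded X0(2)]) blast+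
  have "\<forall>\<^sub>F p in nhds p0. (X1 \<circ> \<tau>1) p = (X2 \<circ> \<tau>2) p"
  proof (rule normalized_curves_coincide[where K = K and w = w and G = G and V = V and e = e
        and \<xi> = "(t0, y0)" and \<delta> = "min d1 d2"])
    show "G (t0, y0) \<bullet> e \<noteq> 0" using assms(8) by (simp add: G_def)
    show "(X1 \<circ> \<tau>1) p0 = (t0, y0)" "(X2 \<circ> \<tau>2) p0 = (t0, y0)" using \<tau>1 \<tau>2 X0 by auto
    show "(X1 \<circ> \<tau>1) p \<bullet> e = p \<and>
        ((X1 \<circ> \<tau>1) has_vector_derivative
          inverse (G ((X1 \<circ> \<tau>1) p) \<bullet> e) *\<^sub>R G ((X1 \<circ> \<tau>1) p)) (at p)"
      if "\<bar>p - p0\<bar> < min d1 d2" for p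
      using \<tau>1(3)[of p] that unfolding o_apply by simp
    show "(X2 \<circ> \<tau>2) p \<bullet> e = p \<and>
        ((X2 \<circ> \<tau>2) has_vector_derivative
          inverse (G ((X2 \<circ> \<tau>2) p) \<bullet> e) *\<^sub>R G ((X2 \<circ> \<tau>2) p)) (at p)"
      if "\<bar>p - p0\<bar> < min d1 d2" for p
      using \<tau>2(3)[of p] that unfolding o_apply by simp
  qed (use assms(3,6,7) Gcont K w lim \<tau>1(1) \<tau>2(1) in auto)
  \<comment> \<open>Coincidence is known for parameters near \<open>p0\<close>; continuity of the
    coordinate of \<open>X1\<close> transfers it to times near \<open>t0\<close>.\<close>
  moreover have "filterlim (\<lambda>t. X1 t \<bullet> e) (nhds p0) (nhds t0)"
  proof -
    have "isCont X1 t0"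
      using has_vector_derivative_continuous[OF r1(2)[of t0]] r1(1) by simp
    then have "isCont (\<lambda>t. X1 t \<bullet> e) t0" by (intro continuous_intros)
    then show ?thesis
      using tendsto_at_iff_tendsto_nhds[of "\<lambda>t. X1 t \<bullet> e" t0] X0(1) by (simp add: isCont_def)
  qed
  ultimately have "\<forall>\<^sub>F t in nhds t0. (X1 \<circ> \<tau>1) (X1 t \<bullet> e) = (X2 \<circ> \<tau>2) (X1 t \<bullet> e)"
    by (rule eventually_compose_filterlim)
  moreover have "\<forall>\<^sub>F t in nhds t0. \<bar>t - t0\<bar> < r1"
    using r1(1) by (auto simp: eventually_nhds_metric dist_real_def)
  ultimately show "\<forall>\<^sub>F t in nhds t0. y t = z t"
  proof eventually_elim
    case (elim t)
    \<comment> \<open>Since \<tau>1 undoes the coordinate of \<open>X1\<close>, the point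
      \<open>X1 t\<close> lies on the second curve, at time \<open>?s\<close>. The time component of
      both graphs is the time itself, so \<open>?s = t\<close>, and the remaining components give
      \<open>y t = z t\<close>.\<close>
    let ?s = "\<tau>2 (X1 t \<bullet> e)"
    have "X1 t = X2 ?s" using elim \<tau>1(4)[of t] by simp
    then have "t = ?s" "y t = z ?s" unfolding X1_def X2_def by blast+
    then show ?case by (rule subst[of ?s t "\<lambda>s. y t = z s", OF sym])
  qed
qed

end
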